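(* Let $n\geq 2$ and $m\in\{1,\ldots,n\}$ be integers, let $\mathsf V=\{1,\ldots,n\}$ and $\mathsf E=\{(i,j)\in \mathsf V^2 : i\neq j\}$. Let $H$ be a (not necessarily commutative) ring, $K$ a commutative ring, and $\tau:H\to K$ a central morphism of $\mathbb Z$-modules, that is, an additive map such that $\tau(rr')=\tau(r'r)$ for all $r,r'\in H$. Let $(h_{ij})_{(i,j)\in\mathsf E}$ be elements of $H$, and let $\Delta\in M_n(H[a_{ij}:(i,j)\in\mathsf E])$ be the matrix with $$\Delta_{ij}=-h_{ij}a_{ij}\quad\text{for } (i,j)\in\mathsf E,\qquad \Delta_{ii}=\sum_{j\in\mathsf V\setminus\{i\}}a_{ij}\quad\text{for } i\in\mathsf V.$$ Let $\Delta_{[m]}$ be the $m\times m$ principal submatrix of $\Delta$ obtained by erasing the rows and columns of indices greater than $m$. Then in the ring $S=K[a_{ij}:(i,j)\in\mathsf E]$ we have $$\det\nolimits_{\tau}\Delta_{[m]}=\sum_{F\in\mathcal F_m}a_F\prod_{c\in\mathcal C(F)}\bigl(1-\tau(h_c)\bigr).$$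
   Context: Polynomial rings: $R=H[a_{ij}:(i,j)\in\mathsf E]$ is the polynomial ring over $H$ in $n(n-1)$ indeterminates which commute with each other and with $H$; $S=K[a_{ij}:(i,j)\in\mathsf E]$. The map $\tau$ is extended coefficientwise to an additive map $R\to S$, still denoted $\tau$. $\tau$-determinant: for an integer $p\geq1$ and a $p\times p$ matrix $M$ with entries in $R$, $$\det\nolimits_\tau(M)=\sum_{\sigma\in\mathfrak S_p}\varepsilon(\sigma)\prod_{\substack{c\text{ cycle of }\sigma\\ c=(i_1\ldots i_r)}}\tau\bigl(M_{i_1i_2}M_{i_2i_3}\cdots M_{i_ri_1}\bigr)\in S,$$ where $\mathfrak S_p$ is the symmetric group on $p$ elements, $\varepsilon(\sigma)$ is the signature, and fixed points count as cycles of length $1$ (this is well defined because $\tau$ is central). Forests: the edge $(i,j)$ goes from $i$ to $j$. The well is $\mathsf W=\{m+1,\ldots,n\}$ and $\mathsf U=\{1,\ldots,m\}$. A cycle-and-well-rooted spanning forest is a subset $F\subset\mathsf E$ containing exactly $m$ edges, one coming out of $i$ for each $i\in\mathsf U$. $\mathcal F_m$ is the set of all of them. For $F\in\mathcal F_m$, $a_F=\prod_{(i,j)\in F}a_{ij}$. Each connected component of $(\mathsf V,F)$ is either a tree rooted at a vertex of $\mathsf W$ with all edges pointing towards the root, or contained in $\mathsf U$ and contains exactly one directed cycle; $\mathcal C(F)$ is the (possibly empty) set of directed cycles of $F$. For a cycle $c\in\mathcal C(F)$ visiting the vertices $i_1,\ldots,i_r$ in this cyclic order, $\tau(h_c)=\tau(h_{i_1i_2}h_{i_2i_3}\cdots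 h_{i_ri_1})$, which does not depend on the starting point of the cycle.
   Formalization: The formal theorem additionally assumes τ(1)=1; without it the identity fails, e.g. n=2, m=1, τ=0, K=ℤ gives det_τ Δ_[1] = τ(1)a_12 = 0 but the forest sum is a_12. *)

theory Defs
  imports Complex_Main "HOL-Library.Poly_Mapping" "HOL-Combinatorics.Permutations"
begin

text \<open>
  Polynomials over a possibly noncommutative coefficient ring, in commuting indeterminates
  \<open>a\<^sub>i\<^sub>j\<close> that also commute with the coefficients: finitely supported maps from monomials
  to coefficients, with the convolution product of \<^theory>\<open>HOL-Library.Poly_Mapping\<close>.
  The indeterminates are indexed by all pairs of naturals. The polynomial ring in the
  \<open>a\<^sub>i\<^sub>j\<close> with \<open>(i, j) \<in> edges n\<close> is the subring of those polynomials in which no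
  other indeterminate occurs, and every polynomial considered here lies in it.
\<close>

type_synonym 'r edge_poly = "(nat \<times> nat \<Rightarrow>\<^sub>0 nat) \<Rightarrow>\<^sub>0 'r"

definition const :: "'r::zero \<Rightarrow> 'r edge_poly" where
  "const r = Poly_Mapping.single 0 r"

definition indet :: "nat \<times> nat \<Rightarrow> 'r::zero_neq_one edge_poly" where
  "indet e = Poly_Mapping.single (Poly_Mapping.single e 1) 1"

text \<open>Coefficientwise extension of a map with \<open>\<tau> 0 = 0\<close>.\<close>

abbreviation extend :: "('r::zero \<Rightarrow> 's::zero) \<Rightarrow> 'r edge_poly \<Rightarrow> 's edge_poly" where
  "extend \<tau> \<equiv> Poly_Mapping.map \<tau>"

definition central :: "('r::times \<Rightarrow> 's) \<Rightarrow> bool" where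
  "central \<tau> \<longleftrightarrow> (\<forall>r r'. \<tau> (r * r') = \<tau> (r' * r))"

lemma lookup_extend:
  assumes "\<tau> 0 = 0"
  shows "Poly_Mapping.lookup (extend \<tau> p) x = \<tau> (Poly_Mapping.lookup p x)"
  using assms by (simp add: Poly_Mapping.map.rep_eq when_def)

lemma additive_extend:
  assumes "Modules.additive \<tau>"
  shows "Modules.additive (extend \<tau>)"
  using assms
  by (intro additive.intro poly_mapping_eqI)
     (simp add: lookup_extend lookup_add additive.zero additive.add)

lemma edge_poly_induct [case_names zero add]:
  assumes "P 0" and "\<And>x r p. P p \<Longrightarrow> P (Poly_Mapping.single x r + p)"
  shows "P (p :: 'r::comm_monoid_add edge_poly)"
proof (induction p rule: update_induct)
  case const
  then show ?case using assms(1) by simp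
next
  case (update p x r)
  then have "Poly_Mapping.update x r p = Poly_Mapping.single x r + p"
    by (intro poly_mapping_eqI)
       (auto simp: lookup_update lookup_add lookup_single when_def in_keys_iff)
  then show ?case using assms(2) update by simp
qed

lemma central_extend:
  fixes \<tau> :: "'h::ring_1 \<Rightarrow> 'k::comm_ring_1"
  assumes "Modules.additive \<tau>" "central \<tau>"
  shows "central (extend \<tau>)"
  unfolding central_def
proof (intro allI)
  interpret E: Modules.additive "extend \<tau>"
    using assms(1) by (rule additive_extend)
  have *: "extend \<tau> (Poly_Mapping.single x r * q) = extend \<tau> (q * Poly_Mapping.single x r)" for x r q
  proof (induction q rule: edge_poly_induct)
    case zero
    then show ?case by simp
  next
    case (add y s q)
    then show ?case
      using assms
      by (simp add: distrib_left distrib_right E.add mult_single map_single additive.zero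
          central_def add.commute)
  qed
  show "extend \<tau> (p * q) = extend \<tau> (q * p)" for p q
    by (induction p rule: edge_poly_induct) (simp_all add: distrib_left distrib_right E.add *)
qed


text \<open>
  The directed cycle \<open>(i\<^sub>1 \<dots> i\<^sub>r)\<close>, with distinct vertices, is represented by its edge set
  \<open>{(i\<^sub>1, i\<^sub>2), \<dots>, (i\<^sub>r, i\<^sub>1)}\<close>, which does not depend on the starting point.
  A loop \<open>(i, i)\<close> is a cycle of length 1.
\<close>

definition cycle_edges :: "'a list \<Rightarrow> ('a \<times> 'a) set" where
  "cycle_edges xs = set (zip xs (rotate1 xs))"

definition directed_cycles :: "('a \<times> 'a) set \<Rightarrow> ('a \<times> 'a) set set" where
  "directed_cycles F = {cycle_edges xs | xs. xs \<noteq> [] \<and> distinct xs \<and> cycle_edges xs \<subseteq> F}"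

text \<open>\<open>cycle_word M [i\<^sub>1, \<dots>, i\<^sub>r] = M i\<^sub>1 i\<^sub>2 * M i\<^sub>2 i\<^sub>3 * \<dots> * M i\<^sub>r i\<^sub>1\<close>, in this order.\<close>

definition cycle_word :: "('a \<Rightarrow> 'a \<Rightarrow> 'r::monoid_mult) \<Rightarrow> 'a list \<Rightarrow> 'r" where
  "cycle_word M xs = prod_list (map (\<lambda>(i, j). M i j) (zip xs (rotate1 xs)))"

text \<open>
  For central \<open>T\<close>, the choice of the starting point is immaterial, see \<open>cycle_trace_eq\<close>.
\<close>

definition cycle_trace ::
  "('r::monoid_mult \<Rightarrow> 's) \<Rightarrow> ('a \<Rightarrow> 'a \<Rightarrow> 'r) \<Rightarrow> ('a \<times> 'a) set \<Rightarrow> 's" where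
  "cycle_trace T M c = T (cycle_word M (SOME xs. xs \<noteq> [] \<and> distinct xs \<and> cycle_edges xs = c))"

lemma cycle_edges_nth:
  assumes "distinct xs" "i < length xs"
  shows "(xs ! i, y) \<in> cycle_edges xs \<longleftrightarrow> y = xs ! (Suc i mod length xs)"
proof -
  have "(xs ! i, y) \<in> cycle_edges xs \<longleftrightarrow>
      (\<exists>k < length xs. xs ! k = xs ! i \<and> y = xs ! (Suc k mod length xs))"
    unfolding cycle_edges_def set_zip mem_Collect_eq by (metis Pair_inject length_rotate1 min.idem nth_rotate1)
  then show ?thesis
    using assms by (metis nth_eq_iff_index_eq)
qed

lemma set_eq_fst_cycle_edges: "set xs = fst ` cycle_edges xs"
  by (metis cycle_edges_def length_rotate1 list.set_map map_fst_zip)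

lemma cycle_edges_eq_imp_rotate:
  assumes xs: "xs \<noteq> []" "distinct xs" and ys: "distinct ys"
    and eq: "cycle_edges ys = cycle_edges xs"
  shows "\<exists>k. ys = rotate k xs"
proof -
  have S: "set ys = set xs"
    using eq by (metis set_eq_fst_cycle_edges)
  then have len: "length ys = length xs"
    using xs ys by (metis distinct_card)
  have pos: "0 < length xs" using xs by simp
  have "ys ! 0 \<in> set xs"
    using S len pos by (metis nth_mem)
  then obtain k where k: "k < length xs" "ys ! 0 = xs ! k"
    by (metis in_set_conv_nth)
  have "ys ! i = xs ! ((k + i) mod length xs)" if "i < length ys" for i
    using that
  proof (induction i)
    case 0
    then show ?case using k by simp
  next
    case (Suc i)
    let ?j = "(k + i) mod length xs"
    have i: "i < length ys" using Suc.prems by simp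
    have "(ys ! i, ys ! Suc i) \<in> cycle_edges xs"
      using cycle_edges_nth[OF ys i, of "ys ! Suc i"] Suc.prems eq by simp
    moreover have "ys ! i = xs ! ?j" using Suc.IH[OF i] .
    ultimately have "ys ! Suc i = xs ! (Suc ?j mod length xs)"
      using cycle_edges_nth[OF xs(2), of ?j] pos by simp
    then show ?case by (simp add: mod_Suc_eq)
  qed
  then have "ys = rotate k xs"
    using len by (intro nth_equalityI) (auto simp: nth_rotate)
  then show ?thesis ..
qed

lemma cycle_word_rotate1:
  assumes "central T"
  shows "T (cycle_word M (rotate1 xs)) = T (cycle_word M xs)"
proof -
  have "zip (rotate1 xs) (rotate1 (rotate1 xs)) = rotate1 (zip xs (rotate1 xs))"
  proof (rule nth_equalityI)
    fix i assume "i < length (zip (rotate1 xs) (rotate1 (rotate1 xs)))"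
    then have "i < length xs" "Suc i mod length xs < length xs"
      by (auto intro: mod_less_divisor)
    then show "zip (rotate1 xs) (rotate1 (rotate1 xs)) ! i = rotate1 (zip xs (rotate1 xs)) ! i"
      by (simp add: nth_rotate1)
  qed simp
  then have "T (cycle_word M (rotate1 xs)) =
      T (prod_list (rotate1 (map (\<lambda>(i, j). M i j) (zip xs (rotate1 xs)))))"
    by (simp add: cycle_word_def rotate1_map)
  also have "\<dots> = T (cycle_word M xs)"
  proof (cases "map (\<lambda>(i, j). M i j) (zip xs (rotate1 xs))")
    case Nil
    then show ?thesis by (simp add: cycle_word_def)
  next
    case (Cons w ws)
    then show ?thesis
      using assms unfolding cycle_word_def Cons central_def by simp
  qed
  finally show ?thesis .
qed

lemma cycle_trace_eq:
  assumes "central T" "xs \<noteq> []" "distinct xs"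
  shows "cycle_trace T M (cycle_edges xs) = T (cycle_word M xs)"
proof -
  let ?P = "\<lambda>ys. ys \<noteq> [] \<and> distinct ys \<and> cycle_edges ys = cycle_edges xs"
  have "?P (SOME ys. ?P ys)"
    using assms by (intro someI[of ?P xs]) simp
  then obtain k where k: "(SOME ys. ?P ys) = rotate k xs"
    using cycle_edges_eq_imp_rotate[OF assms(2,3)] by blast
  have "T (cycle_word M (rotate k xs)) = T (cycle_word M xs)"
    by (induction k) (simp_all add: cycle_word_rotate1[OF assms(1)])
  then show ?thesis by (simp add: cycle_trace_def k)
qed


text \<open>
  A \<open>p \<times> p\<close> matrix is given by its entries with indices in \<open>{1..p}\<close>; other values of \<open>M\<close> are
  ignored, so \<open>det_tau \<tau> m M\<close> is the determinant of the leading principal submatrix of size \<open>m\<close>.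
  The cycles of \<open>\<sigma>\<close>, fixed points included, are the directed cycles of its functional graph.
\<close>

definition det_tau ::
  "('h::ring_1 \<Rightarrow> 'k::comm_ring_1) \<Rightarrow> nat \<Rightarrow> (nat \<Rightarrow> nat \<Rightarrow> 'h edge_poly) \<Rightarrow> 'k edge_poly" where
  "det_tau \<tau> p M =
    (\<Sum>\<sigma> | \<sigma> permutes {1..p}.
       of_int (sign \<sigma>) *
       (\<Prod>c \<in> directed_cycles {(i, \<sigma> i) | i. i \<in> {1..p}}. cycle_trace (extend \<tau>) M c))"

definition edges :: "nat \<Rightarrow> (nat \<times> nat) set" where
  "edges n = {(i, j). i \<in> {1..n} \<and> j \<in> {1..n} \<and> i \<noteq> j}"

definition twisted_laplacian :: "nat \<Rightarrow> (nat \<Rightarrow> nat \<Rightarrow> 'h::ring_1) \<Rightarrow> nat \<Rightarrow> nat \<Rightarrow> 'h edge_poly" where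
  "twisted_laplacian n h i j =
    (if i = j then (\<Sum>k \<in> {1..n} - {i}. indet (i, k)) else - (const (h i j) * indet (i, j)))"

text \<open>Cycle-and-well-rooted spanning forests with well \<open>{m+1..n}\<close>.\<close>

definition forests :: "nat \<Rightarrow> nat \<Rightarrow> (nat \<times> nat) set set" where
  "forests n m = {F. F \<subseteq> edges n \<and> card F = m \<and> (\<forall>i \<in> {1..m}. \<exists>!j. (i, j) \<in> F)}"

end

theory Submission
  imports Defs "HOL-Combinatorics.Cycles"
begin

text \<open>
  The theorem is an identity between two expansions into monomials with coefficients in \<open>K\<close>.

  On the determinant side, the sign of a permutation \<open>p\<close> is the product of \<open>- (- 1)\<^sup>r\<close> over its
  cycles, \<open>r\<close> being the length. A cycle \<open>c\<close> of length \<open>r \<ge> 2\<close> meets only off-diagonal entries of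
  the Laplacian, so \<open>\<tau>\<close> sends its word to \<open>(- 1)\<^sup>r \<tau>(h\<^sub>c) a\<^sub>c\<close> and, sign included, it contributes
  \<open>- \<tau>(h\<^sub>c) a\<^sub>c\<close>. A fixed point \<open>i\<close> contributes the diagonal entry, a sum of \<open>a\<^sub>i\<^sub>k\<close> over \<open>k \<noteq> i\<close>.
  Expanding these sums chooses an outgoing edge at every fixed point; at the points moved by \<open>p\<close>
  the cycles already provide one. Hence the determinant is a sum over pairs \<open>(p, g)\<close> where \<open>g\<close> is
  a map without fixed points from \<open>{1..m}\<close> to \<open>{1..n}\<close>, \<open>p\<close> is a permutation of \<open>{1..m}\<close>, and \<open>g\<close>
  agrees with \<open>p\<close> wherever \<open>p\<close> moves a point (lemma \<open>det_tau_summand\<close>).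

  On the forest side, a forest is the graph of such a map \<open>g\<close> (lemma \<open>bij_betw_forests\<close>), and
  expanding the product of the \<open>1 - \<tau>(h\<^sub>c)\<close> chooses a set of cycles of the graph.

  The two sums agree because, for fixed \<open>g\<close>, a permutation \<open>p\<close> as above amounts to the set of its
  cycles of length at least 2, which can be any set of directed cycles of \<open>g\<close>
  (lemma \<open>bij_betw_proper_cycles\<close>). This rests on the fact that distinct cycles of a functional
  graph are vertex-disjoint (lemma \<open>directed_cycles_disjoint\<close>).
\<close>

section \<open>Directed cycles of functional graphs\<close>

abbreviation graph_of :: "'a set \<Rightarrow> ('a \<Rightarrow> 'b) \<Rightarrow> ('a \<times> 'b) set" where
  "graph_of A g \<equiv> {(i, g i) | i. i \<in> A}"

lemma graph_of_eq_image: "graph_of A g = (\<lambda>i. (i, g i)) ` A"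
  by auto

lemma finite_directed_cycles:
  assumes "finite F"
  shows "finite (directed_cycles F)"
proof (rule finite_subset)
  show "directed_cycles F \<subseteq> Pow F"
    by (auto simp: directed_cycles_def)
qed (use assms in simp)

lemma directed_cycle_subset: "c \<in> directed_cycles F \<Longrightarrow> c \<subseteq> F"
  by (auto simp: directed_cycles_def)

lemma directed_cycle_iff_subset:
  "c \<in> directed_cycles F \<Longrightarrow> c \<in> directed_cycles F' \<longleftrightarrow> c \<subseteq> F'"
  by (auto simp: directed_cycles_def)

lemma snd_cycle_edges: "snd ` cycle_edges xs = set xs"
  by (metis cycle_edges_def length_rotate1 list.set_map map_snd_zip set_rotate1)

lemma fst_directed_cycle_eq_snd:
  assumes "c \<in> directed_cycles F"
  shows "fst ` c = snd ` c"
proof -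
  obtain xs where "c = cycle_edges xs"
    using assms by (auto simp: directed_cycles_def)
  then show ?thesis
    using set_eq_fst_cycle_edges[of xs] snd_cycle_edges[of xs] by simp
qed

lemma directed_cycle_nonempty:
  assumes "c \<in> directed_cycles F"
  shows "c \<noteq> {}"
proof -
  obtain xs where "c = cycle_edges xs" "xs \<noteq> []"
    using assms by (auto simp: directed_cycles_def)
  then show ?thesis
    using set_eq_fst_cycle_edges[of xs] by auto
qed

lemma directed_cycles_empty: "directed_cycles {} = {}"
  using directed_cycle_subset[of _ "{}"] directed_cycle_nonempty[of _ "{}"] by blast

text \<open>
  In a functional graph the successor of a vertex is forced, so a directed cycle is recovered from
  any one of its vertices by iterating the map.
\<close>

lemma directed_cycle_eq_orbit:
  assumes c: "c \<in> directed_cycles (graph_of A g)" and i: "i \<in> fst ` c"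
  shows "c = range (\<lambda>k. ((g ^^ k) i, (g ^^ Suc k) i))"
proof -
  obtain xs where xs: "c = cycle_edges xs" "xs \<noteq> []" "distinct xs" "cycle_edges xs \<subseteq> graph_of A g"
    using c by (auto simp: directed_cycles_def)
  let ?n = "length xs"
  have n: "?n > 0" using xs by simp
  obtain j where j: "j < ?n" "xs ! j = i"
    using i xs(1) by (metis in_set_conv_nth set_eq_fst_cycle_edges)
  have step: "xs ! (Suc l mod ?n) = g (xs ! l)" if "l < ?n" for l
    using cycle_edges_nth[OF xs(3) that, of "xs ! (Suc l mod ?n)"] xs(4) by auto
  have pow: "(g ^^ k) i = xs ! ((j + k) mod ?n)" for k
  proof (induction k)
    case (Suc k)
    then show ?case
      using step[of "(j + k) mod ?n"] n by (simp add: mod_Suc_eq)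
  qed (use j in simp)
  have "c = (\<lambda>l. (xs ! l, xs ! (Suc l mod ?n))) ` {..<?n}"
    unfolding xs(1) cycle_edges_def set_zip by (auto simp: nth_rotate1)
  also have "{..<?n} = range (\<lambda>k. (j + k) mod ?n)"
  proof
    show "{..<?n} \<subseteq> range (\<lambda>k. (j + k) mod ?n)"
    proof
      fix l assume "l \<in> {..<?n}"
      \<comment> \<open>\<open>?n\<close> is added before \<open>j\<close> is subtracted to avoid truncation\<close>
      then have "l = (j + (l + ?n - j)) mod ?n"
        using j by simp
      then show "l \<in> range (\<lambda>k. (j + k) mod ?n)" by blast
    qed
  qed (use n in auto)
  also have "(\<lambda>l. (xs ! l, xs ! (Suc l mod ?n))) ` range (\<lambda>k. (j + k) mod ?n)
      = range (\<lambda>k. ((g ^^ k) i, (g ^^ Suc k) i))"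
    unfolding image_image pow by (simp add: mod_Suc_eq)
  finally show ?thesis .
qed

lemma directed_cycles_disjoint:
  assumes "c \<in> directed_cycles (graph_of A g)" "d \<in> directed_cycles (graph_of A g)"
    and "i \<in> fst ` c" "i \<in> fst ` d"
  shows "c = d"
  using directed_cycle_eq_orbit[OF assms(1,3)] directed_cycle_eq_orbit[OF assms(2,4)] by simp

text \<open>Excluding loops leaves the cycles of length at least 2.\<close>

definition proper_cycles :: "'a set \<Rightarrow> ('a \<Rightarrow> 'a) \<Rightarrow> ('a \<times> 'a) set set" where
  "proper_cycles A g = {c \<in> directed_cycles (graph_of A g). c \<inter> Id = {}}"

lemma directed_cycles_eq_loops_proper:
  "directed_cycles (graph_of A g) = (\<lambda>i. {(i, i)}) ` {i \<in> A. g i = i} \<union> proper_cycles A g"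
    (is "?D = ?L \<union> _")
proof -
  have "c \<in> ?L" if c: "c \<in> ?D" and "c \<notin> proper_cycles A g" for c
  proof -
    have "c \<inter> Id \<noteq> {}"
      using that by (simp add: proper_cycles_def)
    then obtain i where i: "(i, i) \<in> c"
      by fastforce
    then have *: "i \<in> A" "g i = i"
      using directed_cycle_subset[OF c] by auto
    have "(g ^^ k) i = i" for k
      by (induction k) (simp_all add: *)
    then have "c = {(i, i)}"
      using directed_cycle_eq_orbit[OF c, of i] i * by (force simp: image_iff)
    then show ?thesis using * by blast
  qed
  moreover have "{(i, i)} \<in> ?D" if "i \<in> A" "g i = i" for i
    using that unfolding directed_cycles_def
    by (auto simp: cycle_edges_def intro!: exI[of _ "[i]"])
  ultimately show ?thesis
    by (auto simp: proper_cycles_def)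
qed


section \<open>Cycles of permutations\<close>

lemma sign_cycle_of_list: "distinct xs \<Longrightarrow> xs \<noteq> [] \<Longrightarrow> sign (cycle_of_list xs) = - ((- 1) ^ length xs)"
proof (induction xs rule: cycle_of_list.induct)
  case (1 i j cs)
  have "sign (cycle_of_list (i # j # cs)) = sign (transpose i j) * sign (cycle_of_list (j # cs))"
    by (simp only: cycle_of_list.simps sign_compose permutation_swap_id permutation_of_cycle)
  also have "\<dots> = - ((- 1) ^ length (i # j # cs))"
    using 1 by (simp add: sign_swap_id)
  finally show ?case .
qed (auto simp: sign_id)

lemma graph_cycle_of_list:
  assumes "distinct xs"
  shows "graph_of (set xs) (cycle_of_list xs) = cycle_edges xs"
proof -
  have "map (cycle_of_list xs) xs = rotate1 xs"
    using cyclic_rotation[OF assms, of 1] by simp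
  then have "cycle_edges xs = set (zip xs (map (cycle_of_list xs) xs))"
    by (simp add: cycle_edges_def)
  then show ?thesis
    by (auto simp: zip_map2 zip_same_conv_map)
qed

lemma card_cycle_edges:
  assumes "distinct xs"
  shows "card (cycle_edges xs) = length xs"
proof -
  have "distinct (zip xs (rotate1 xs))"
    using assms by (simp add: distinct_zipI1)
  then show ?thesis
    by (simp add: cycle_edges_def distinct_card)
qed

lemma cycle_decomp_permutes: "cycle_decomp S p \<Longrightarrow> p permutes S \<and> finite S"
proof (induction rule: cycle_decomp.induct)
  case empty
  show ?case using permutes_id by blast
next
  case (comp I p cs)
  then show ?case
    by (metis List.finite_set Un_upper1 Un_upper2 cycle_permutes finite_UnI permutes_compose
        permutes_subset)
qed

text \<open>
  The induction step for permutations built up by multiplying disjoint cycles: on \<open>set xs\<close> and on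
  \<open>I\<close> the composite agrees with one factor each, so its graph is the union of the two graphs, and
  a cycle of this union other than \<open>cycle_edges xs\<close> avoids \<open>set xs\<close> by disjointness of cycles.
\<close>

lemma directed_cycles_compose_cycle:
  assumes p: "p permutes I" and xs: "distinct xs" "xs \<noteq> []" "set xs \<inter> I = {}"
  shows "directed_cycles (graph_of (set xs \<union> I) (cycle_of_list xs \<circ> p))
      = insert (cycle_edges xs) (directed_cycles (graph_of I p))"
    and "graph_of (set xs \<union> I) (cycle_of_list xs \<circ> p) = cycle_edges xs \<union> graph_of I p"
    and "cycle_edges xs \<notin> directed_cycles (graph_of I p)"
proof -
  let ?q = "cycle_of_list xs \<circ> p"
  let ?G = "graph_of (set xs \<union> I) ?q"
  have "?q i = cycle_of_list xs i" if "i \<in> set xs" for i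
    using that xs p by (metis comp_apply disjoint_iff permutes_not_in)
  then have 1: "graph_of (set xs) ?q = cycle_edges xs"
    unfolding graph_cycle_of_list[OF xs(1), symmetric] graph_of_eq_image by (intro image_cong) auto
  have "?q i = p i" if "i \<in> I" for i
    using that xs(3) permutes_in_image[OF p, of i] by (auto intro!: id_outside_supp)
  then have 2: "graph_of I ?q = graph_of I p"
    unfolding graph_of_eq_image by (intro image_cong) auto
  show G: "?G = cycle_edges xs \<union> graph_of I p"
    unfolding 1[symmetric] 2[symmetric] by auto
  have xs_D: "cycle_edges xs \<in> directed_cycles ?G"
    using G xs by (auto simp: directed_cycles_def)
  have "c \<in> directed_cycles (graph_of I p)" if c: "c \<in> directed_cycles ?G" "c \<noteq> cycle_edges xs" for c
  proof -
    have "fst ` c \<inter> fst ` cycle_edges xs = {}"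
      using directed_cycles_disjoint[OF c(1) xs_D] c(2) by blast
    then have "c \<subseteq> graph_of I p"
      using directed_cycle_subset[OF c(1)] unfolding G by blast
    then show ?thesis
      using directed_cycle_iff_subset[OF c(1)] by simp
  qed
  then show "directed_cycles ?G = insert (cycle_edges xs) (directed_cycles (graph_of I p))"
    using xs_D G by (auto simp: directed_cycles_def)
  show "cycle_edges xs \<notin> directed_cycles (graph_of I p)"
  proof
    assume "cycle_edges xs \<in> directed_cycles (graph_of I p)"
    then have "fst ` cycle_edges xs \<subseteq> I"
      using directed_cycle_subset by fastforce
    then show False
      using xs by (cases xs) (auto simp flip: set_eq_fst_cycle_edges)
  qed
qed

text \<open>
  Both properties follow by the same induction over the decomposition into disjoint cycles: each
  new cycle multiplies the sign by its own sign and adds its edges to the graph. The step is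
  trivial when the new cycle is the empty list, whose permutation is the identity.
\<close>

lemma cycle_decomp_sign_and_cover:
  assumes "cycle_decomp S p"
  shows "sign p = (\<Prod>c \<in> directed_cycles (graph_of S p). - ((- 1) ^ card c))
    \<and> \<Union> (directed_cycles (graph_of S p)) = graph_of S p"
  using assms
proof (induction rule: cycle_decomp.induct)
  case empty
  show ?case by (simp add: directed_cycles_empty)
next
  case (comp I p xs)
  show ?case
  proof (cases "xs = []")
    case True
    then show ?thesis using comp.IH by simp
  next
    case False
    have p: "p permutes I" "finite I"
      using cycle_decomp_permutes[OF comp.hyps(1)] by auto
    then have "permutation p"
      by (auto simp: permutation_permutes)
    moreover have "finite (directed_cycles (graph_of I p))"
      using p by (intro finite_directed_cycles) (simp add: graph_of_eq_image)
    moreover note new = directed_cycles_compose_cycle[OF p(1) comp.hyps(2) False comp.hyps(3)]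
    ultimately have "(\<Prod>c \<in> directed_cycles (graph_of (set xs \<union> I) (cycle_of_list xs \<circ> p)). - ((- 1) ^ card c))
        = - ((- 1) ^ length xs) * sign p"
      using comp.IH comp.hyps(2) unfolding new(1) by (simp add: new(3) card_cycle_edges)
    moreover have "sign (cycle_of_list xs \<circ> p) = - ((- 1) ^ length xs) * sign p"
      using sign_compose[OF permutation_of_cycle \<open>permutation p\<close>]
        sign_cycle_of_list[OF comp.hyps(2) False] by metis
    moreover have "\<Union> (directed_cycles (graph_of (set xs \<union> I) (cycle_of_list xs \<circ> p)))
        = graph_of (set xs \<union> I) (cycle_of_list xs \<circ> p)"
      using comp.IH unfolding new(1) unfolding new(2) by simp
    ultimately show ?thesis by metis
  qed
qed

lemma sign_eq_prod_cycles:
  assumes "p permutes S" "finite S"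
  shows "sign p = (\<Prod>c \<in> directed_cycles (graph_of S p). - ((- 1) ^ card c))"
  using cycle_decomp_sign_and_cover[OF cycle_decomposition[OF assms]] by blast

lemma Union_proper_cycles:
  assumes "p permutes S" "finite S"
  shows "\<Union> (proper_cycles S p) = graph_of {i \<in> S. p i \<noteq> i} p"
proof -
  have "(\<Union>i \<in> {i \<in> S. p i = i}. {(i, i)}) \<union> \<Union> (proper_cycles S p) = graph_of S p"
    using cycle_decomp_sign_and_cover[OF cycle_decomposition[OF assms]]
    by (simp add: directed_cycles_eq_loops_proper)
  moreover have "\<Union> (proper_cycles S p) \<inter> Id = {}"
    by (auto simp: proper_cycles_def)
  moreover have "(\<Union>i \<in> {i \<in> S. p i = i}. {(i, i)}) \<subseteq> Id"
    by auto
  ultimately have "\<Union> (proper_cycles S p) = graph_of S p - (\<Union>i \<in> {i \<in> S. p i = i}. {(i, i)})"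
    by blast
  then show ?thesis by auto
qed

lemma prod_directed_cycles_split:
  fixes w :: "('a \<times> 'a) set \<Rightarrow> 'r::comm_monoid_mult"
  assumes "finite S"
  shows "(\<Prod>c \<in> directed_cycles (graph_of S p). w c)
    = (\<Prod>i | i \<in> S \<and> p i = i. w {(i, i)}) * (\<Prod>c \<in> proper_cycles S p. w c)"
proof -
  have "finite (directed_cycles (graph_of S p))"
    using assms by (intro finite_directed_cycles) (simp add: graph_of_eq_image)
  then have fin: "finite (proper_cycles S p)"
    by (simp add: proper_cycles_def)
  have "inj_on (\<lambda>i. {(i, i)}) {i \<in> S. p i = i}"
    by (auto simp: inj_on_def)
  moreover have "(\<lambda>i. {(i, i)}) ` {i \<in> S. p i = i} \<inter> proper_cycles S p = {}"
    by (auto simp: proper_cycles_def)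
  ultimately show ?thesis
    unfolding directed_cycles_eq_loops_proper using assms fin
    by (subst prod.union_disjoint) (auto simp: prod.reindex)
qed

lemma prod_proper_cycles_edges:
  fixes f :: "'a \<times> 'a \<Rightarrow> 'r::comm_monoid_mult"
  assumes "p permutes S" "finite S"
  shows "(\<Prod>c \<in> proper_cycles S p. \<Prod>e \<in> c. f e) = (\<Prod>i | i \<in> S \<and> p i \<noteq> i. f (i, p i))"
proof -
  have fin: "finite (graph_of S p)"
    using assms by (simp add: graph_of_eq_image)
  have "c \<inter> d = {}" if "c \<in> proper_cycles S p" "d \<in> proper_cycles S p" "c \<noteq> d" for c d
    using directed_cycles_disjoint[of c p S d] that by (fastforce simp: proper_cycles_def)
  moreover have "finite c" if "c \<in> proper_cycles S p" for c
  proof (rule finite_subset)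
    show "c \<subseteq> graph_of S p"
      using that by (simp add: proper_cycles_def directed_cycle_subset)
  qed (rule fin)
  ultimately have "(\<Prod>c \<in> proper_cycles S p. \<Prod>e \<in> c. f e) = (\<Prod>e \<in> \<Union> (proper_cycles S p). f e)"
    by (subst prod.Union_disjoint) auto
  also have "\<dots> = (\<Prod>i | i \<in> S \<and> p i \<noteq> i. f (i, p i))"
    unfolding Union_proper_cycles[OF assms] graph_of_eq_image
    by (subst prod.reindex) (auto simp: inj_on_def)
  finally show ?thesis .
qed


section \<open>Sub-permutations of a map and sets of its cycles\<close>

text \<open>
  The combinatorial core of the proof. A permutation that follows \<open>g\<close> at the points it moves is
  determined by its proper cycles, since these cover exactly the moved points; and those cycles
  are cycles of \<open>g\<close>. Conversely, given a set \<open>C\<close> of cycles of \<open>g\<close>, the map that follows \<open>g\<close> on the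
  vertices of \<open>C\<close> and fixes the other points is a permutation, because every vertex of a cycle has
  a predecessor in it. As \<open>g\<close> has no fixed point, this permutation moves all vertices of \<open>C\<close>, and
  disjointness of cycles shows that it has no other proper cycle.
\<close>

lemma bij_betw_proper_cycles:
  fixes g :: "'a \<Rightarrow> 'a"
  assumes fin: "finite S" and nofix: "\<And>i. i \<in> S \<Longrightarrow> g i \<noteq> i"
  shows "bij_betw (proper_cycles S) {p. p permutes S \<and> (\<forall>i \<in> S. p i \<noteq> i \<longrightarrow> g i = p i)}
    (Pow (directed_cycles (graph_of S g)))"
    (is "bij_betw _ ?P (Pow ?D)")
proof (rule bij_betw_imageI)
  have into: "proper_cycles S p \<subseteq> ?D" if p: "p \<in> ?P" for p
  proof
    fix c assume "c \<in> proper_cycles S p"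
    then have c: "c \<in> directed_cycles (graph_of S p)" and "c \<subseteq> graph_of {i \<in> S. p i \<noteq> i} p"
      using Union_proper_cycles[of p S] p fin by (auto simp: proper_cycles_def)
    then have "c \<subseteq> graph_of S g"
      using p by fastforce
    then show "c \<in> ?D"
      using directed_cycle_iff_subset[OF c] by simp
  qed
  show "inj_on (proper_cycles S) ?P"
  proof (rule inj_onI)
    fix p q assume p: "p \<in> ?P" and q: "q \<in> ?P" and eq: "proper_cycles S p = proper_cycles S q"
    then have "graph_of {i \<in> S. p i \<noteq> i} p = graph_of {i \<in> S. q i \<noteq> i} q"
      using Union_proper_cycles[of p S] Union_proper_cycles[of q S] fin by simp
    then have *: "i \<in> S \<and> p i \<noteq> i \<and> j = p i \<longleftrightarrow> i \<in> S \<and> q i \<noteq> i \<and> j = q i" for i j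
      by (auto simp: set_eq_iff)
    show "p = q"
    proof
      fix i show "p i = q i"
        using *[of i "p i"] *[of i "q i"] p q by (metis (no_types, lifting) mem_Collect_eq permutes_not_in)
    qed
  qed
  have "\<exists>p \<in> ?P. proper_cycles S p = C" if C: "C \<subseteq> ?D" for C
  proof
    \<comment> \<open>follow \<open>g\<close> on the vertices of the chosen cycles, stay put elsewhere\<close>
    define p where "p i = (if \<exists>c \<in> C. i \<in> fst ` c then g i else i)" for i
    have sub: "c \<subseteq> graph_of S g" if "c \<in> C" for c
      using C that directed_cycle_subset by blast
    have verts: "fst ` c \<subseteq> S" if "c \<in> C" for c
      using sub[OF that] by auto
    have p_on: "p i = j" if "c \<in> C" "(i, j) \<in> c" for c i j
    proof -
      have "i \<in> fst ` c" using that(2) by force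
      then show ?thesis
        using that sub[OF that(1)] by (auto simp: p_def)
    qed
    have fst_snd: "fst ` c = snd ` c" if "c \<in> C" for c
      using C that by (intro fst_directed_cycle_eq_snd) blast
    have "p i \<in> S" if "i \<in> S" for i
    proof (cases "\<exists>c \<in> C. i \<in> fst ` c")
      case True
      then obtain c j where c: "c \<in> C" "(i, j) \<in> c" by auto
      then have "j \<in> fst ` c" using fst_snd[OF c(1)] by force
      then show ?thesis using verts c p_on by blast
    qed (use that in \<open>simp add: p_def\<close>)
    moreover have "i \<in> p ` S" if "i \<in> S" for i
    proof (cases "\<exists>c \<in> C. i \<in> fst ` c")
      case True
      then obtain c where c: "c \<in> C" "i \<in> snd ` c" using fst_snd by blast
      then obtain j where j: "(j, i) \<in> c" by auto
      then have "j \<in> S" using verts[OF c(1)] by force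
      then show ?thesis using p_on[OF c(1) j] by blast
    next
      case False
      then show ?thesis using that by (force simp: p_def)
    qed
    \<comment> \<open>on a finite set surjectivity suffices\<close>
    ultimately have surj: "p ` S = S" by blast
    then have "bij_betw p S S"
      using fin by (simp add: bij_betw_def eq_card_imp_inj_on)
    moreover have "p i = i" if "i \<notin> S" for i
      using that verts unfolding p_def by (metis subsetD)
    ultimately have perm: "p permutes S"
      by (rule bij_imp_permutes)
    then show pP: "p \<in> ?P"
      by (auto simp: p_def)
    show "proper_cycles S p = C"
    proof
      show "C \<subseteq> proper_cycles S p"
      proof
        fix c assume c: "c \<in> C"
        then have "c \<subseteq> graph_of S p"
          using verts[OF c] p_on[OF c] by (force simp: image_subset_iff)
        moreover have "c \<inter> Id = {}"
          using sub[OF c] nofix by fastforce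
        ultimately show "c \<in> proper_cycles S p"
          using C c directed_cycle_iff_subset[of c] by (auto simp: proper_cycles_def)
      qed
      show "proper_cycles S p \<subseteq> C"
      proof
        fix c assume c: "c \<in> proper_cycles S p"
        then have cD: "c \<in> ?D" using into[OF pP] by blast
        then obtain i j where ij: "(i, j) \<in> c"
          using directed_cycle_nonempty by fastforce
        then have "(i, j) \<in> graph_of {i \<in> S. p i \<noteq> i} p"
          using Union_proper_cycles[OF perm fin] c by blast
        then have "p i \<noteq> i" by blast
        then obtain d where d: "d \<in> C" "i \<in> fst ` d"
          unfolding p_def by metis
        have "i \<in> fst ` c" using ij by force
        then have "c = d"
          using directed_cycles_disjoint[OF cD, of d i] d C by blast
        then show "c \<in> C" using d by simp
      qed
    qed
  qed
  then have "Pow ?D \<subseteq> proper_cycles S ` ?P"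
    by (metis (no_types, lifting) PowD image_eqI subsetI)
  moreover have "proper_cycles S ` ?P \<subseteq> Pow ?D"
    using into by blast
  ultimately show "proper_cycles S ` ?P = Pow ?D"
    by blast
qed


section \<open>Forests as graphs of maps\<close>

text \<open>
  A forest contains the graph of the map that picks the edge out of each vertex of \<open>{1..m}\<close>, and
  both sets have \<open>m\<close> elements, so a forest has no edge out of the well.
\<close>

lemma bij_betw_forests:
  assumes "m \<le> n"
  shows "bij_betw (graph_of {1..m}) (PiE {1..m} (\<lambda>i. {1..n} - {i})) (forests n m)"
    (is "bij_betw _ ?G _")
proof (rule bij_betw_imageI)
  have card_graph: "card (graph_of {1..m} g) = m" for g :: "nat \<Rightarrow> nat"
    unfolding graph_of_eq_image by (subst card_image) (auto simp: inj_on_def)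
  show "inj_on (graph_of {1..m}) ?G"
  proof (rule inj_onI)
    fix f g assume f: "f \<in> ?G" and g: "g \<in> ?G" and eq: "graph_of {1..m} f = graph_of {1..m} g"
    then have "f i = g i" if "i \<in> {1..m}" for i
      using that by (auto simp: set_eq_iff)
    then show "f = g"
      using f g by (intro PiE_ext) auto
  qed
  have "graph_of {1..m} g \<in> forests n m" if "g \<in> ?G" for g
  proof -
    have "graph_of {1..m} g \<subseteq> edges n"
      using that assms by (fastforce simp: edges_def PiE_iff)
    then show ?thesis
      using card_graph[of g] by (simp add: forests_def)
  qed
  moreover have "F \<in> graph_of {1..m} ` ?G" if F: "F \<in> forests n m" for F
  proof -
    define g where "g = restrict (\<lambda>i. THE j. (i, j) \<in> F) {1..m}"
    have gF: "(i, g i) \<in> F" if "i \<in> {1..m}" for i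
    proof -
      have "\<exists>!j. (i, j) \<in> F"
        using F that by (simp add: forests_def)
      from theI'[OF this] show ?thesis
        using that by (simp add: g_def)
    qed
    have "F \<subseteq> edges n" "card F = m"
      using F by (auto simp: forests_def)
    moreover have "finite (edges n)"
      by (rule finite_subset[of _ "{1..n} \<times> {1..n}"]) (auto simp: edges_def)
    ultimately have "finite F" "card F = m"
      using finite_subset by auto
    then have "graph_of {1..m} g = F"
      using gF card_graph[of g] by (intro card_subset_eq) auto
    moreover have "g \<in> ?G"
      using gF \<open>F \<subseteq> edges n\<close> by (fastforce simp: edges_def PiE_iff g_def)
    ultimately show ?thesis by blast
  qed
  ultimately show "graph_of {1..m} ` ?G = forests n m"
    by blast
qed


section \<open>Weights of the cycles in the determinant\<close>

lemma prod_list_single: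
  "prod_list (map (\<lambda>e. Poly_Mapping.single (x e) (r e)) es)
    = Poly_Mapping.single (sum_list (map x es)) (prod_list (map r es) :: 'r::ring_1)"
  by (induction es) (simp_all add: mult_single flip: single_one)

lemma prod_list_uminus:
  "prod_list (map (\<lambda>e. - r e) es) = (- 1) ^ length es * (prod_list (map r es) :: 'r::ring_1)"
  by (induction es) (simp_all add: power_commuting_commutes mult.assoc)

lemma additive_neg_one_power:
  fixes \<tau> :: "'h::ring_1 \<Rightarrow> 'k::ring_1"
  assumes "Modules.additive \<tau>"
  shows "\<tau> ((- 1) ^ k * r) = (- 1) ^ k * \<tau> r"
  by (cases "even k") (simp_all add: additive.minus[OF assms])

text \<open>
  Away from the diagonal every entry of the Laplacian is a monomial, so the word of the cycle is a
  single monomial, with the word of \<open>h\<close> as coefficient up to sign; the order of the \<open>h\<^sub>i\<^sub>j\<close> is kept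
  although the indeterminates commute. Centrality of \<open>\<tau>\<close> makes both traces computable from the
  same starting point.
\<close>

lemma cycle_trace_twisted_laplacian:
  fixes h :: "nat \<Rightarrow> nat \<Rightarrow> 'h::ring_1" and \<tau> :: "'h \<Rightarrow> 'k::comm_ring_1"
  assumes \<tau>: "Modules.additive \<tau>" "central \<tau>"
    and c: "c \<in> directed_cycles F" "c \<inter> Id = {}"
  shows "cycle_trace (extend \<tau>) (twisted_laplacian n h) c
    = (- 1) ^ card c * const (cycle_trace \<tau> h c) * (\<Prod>e \<in> c. indet e)"
proof -
  obtain xs where xs: "c = cycle_edges xs" "xs \<noteq> []" "distinct xs"
    using c by (auto simp: directed_cycles_def)
  let ?es = "zip xs (rotate1 xs)"
  let ?x = "\<lambda>e. Poly_Mapping.single e (1 :: nat)"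
  have es: "distinct ?es" "set ?es = c"
    using xs by (simp_all add: distinct_zipI1 cycle_edges_def)
  have "cycle_word (twisted_laplacian n h) xs
      = prod_list (map (\<lambda>e. Poly_Mapping.single (?x e) (- case_prod h e)) ?es)"
    unfolding cycle_word_def
  proof (intro arg_cong[of _ _ prod_list] map_cong refl)
    fix e assume "e \<in> set ?es"
    then have "e \<notin> Id" using es c by blast
    then show "(case e of (i, j) \<Rightarrow> twisted_laplacian n h i j)
        = Poly_Mapping.single (?x e) (- case_prod h e)"
      by (auto simp: twisted_laplacian_def const_def indet_def mult_single single_uminus split: prod.splits)
  qed
  also have "\<dots> = Poly_Mapping.single (sum_list (map ?x ?es)) ((- 1) ^ card c * cycle_word h xs)"
    unfolding prod_list_single prod_list_uminus cycle_word_def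
    using xs by (simp add: card_cycle_edges)
  finally have word: "cycle_word (twisted_laplacian n h) xs = \<dots>" .
  have indets: "(\<Prod>e \<in> c. indet e) = Poly_Mapping.single (sum_list (map ?x ?es)) (1 :: 'k)"
  proof -
    have "(\<Prod>e \<in> c. indet e) = prod_list (map (\<lambda>e. Poly_Mapping.single (?x e) (1 :: 'k)) ?es)"
      using prod.distinct_set_conv_list[OF es(1), of indet] unfolding es(2) indet_def .
    then show ?thesis
      unfolding prod_list_single by (simp add: map_replicate_const)
  qed
  have "(- 1) ^ k * Poly_Mapping.single x r = Poly_Mapping.single x ((- 1) ^ k * r)"
    for k and x :: "nat \<times> nat \<Rightarrow>\<^sub>0 nat" and r :: 'k
    by (cases "even k") (simp_all add: single_uminus)
  then show ?thesis
    using cycle_trace_eq[OF \<tau>(2) xs(2,3), of h]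
      cycle_trace_eq[OF central_extend[OF \<tau>] xs(2,3), of "twisted_laplacian n h"]
    by (simp add: xs(1)[symmetric] word indets additive.zero[OF \<tau>(1)] additive_neg_one_power[OF \<tau>(1)]
        const_def mult_single mult.assoc)
qed

lemma cycle_trace_twisted_laplacian_loop:
  fixes h :: "nat \<Rightarrow> nat \<Rightarrow> 'h::ring_1" and \<tau> :: "'h \<Rightarrow> 'k::comm_ring_1"
  assumes \<tau>: "Modules.additive \<tau>" "central \<tau>" "\<tau> 1 = 1"
  shows "cycle_trace (extend \<tau>) (twisted_laplacian n h) {(i, i)} = (\<Sum>k \<in> {1..n} - {i}. indet (i, k))"
proof -
  have "cycle_trace (extend \<tau>) (twisted_laplacian n h) {(i, i)} = extend \<tau> (twisted_laplacian n h i i)"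
    using cycle_trace_eq[OF central_extend[OF \<tau>(1,2)], of "[i]" "twisted_laplacian n h"]
    by (simp add: cycle_edges_def cycle_word_def)
  also have "\<dots> = (\<Sum>k \<in> {1..n} - {i}. extend \<tau> (indet (i, k)))"
    by (simp add: twisted_laplacian_def additive.sum[OF additive_extend[OF \<tau>(1)]])
  also have "\<dots> = (\<Sum>k \<in> {1..n} - {i}. indet (i, k))"
    by (simp add: indet_def \<tau>(3) additive.zero[OF \<tau>(1)])
  finally show ?thesis .
qed

text \<open>
  The sign is distributed over the cycles and cancels the signs of the off-diagonal entries, up to
  one factor \<open>- 1\<close> per proper cycle. The sums at the fixed points and the single edges at the moved
  points then combine into one product of sums over \<open>{1..m}\<close>, which is expanded by distributivity.
\<close>

lemma det_tau_summand:
  fixes h :: "nat \<Rightarrow> nat \<Rightarrow> 'h::ring_1" and \<tau> :: "'h \<Rightarrow> 'k::comm_ring_1"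
  assumes \<tau>: "Modules.additive \<tau>" "central \<tau>" "\<tau> 1 = 1"
    and "m \<le> n" and p: "p permutes {1..m}"
  shows "of_int (sign p) *
      (\<Prod>c \<in> directed_cycles (graph_of {1..m} p). cycle_trace (extend \<tau>) (twisted_laplacian n h) c)
    = (\<Prod>c \<in> proper_cycles {1..m} p. - const (cycle_trace \<tau> h c)) *
      (\<Sum>g | g \<in> PiE {1..m} (\<lambda>i. {1..n} - {i}) \<and> (\<forall>i \<in> {1..m}. p i \<noteq> i \<longrightarrow> g i = p i).
         \<Prod>i \<in> {1..m}. indet (i, g i))"
proof -
  let ?U = "{1..m}" and ?V = "\<lambda>i. {1..n} - {i}"
  let ?w = "\<lambda>c. - ((- 1) ^ card c) * cycle_trace (extend \<tau>) (twisted_laplacian n h) c"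
  \<comment> \<open>the admissible values of \<open>g i\<close>: free at a fixed point of \<open>p\<close>, forced at a moved point\<close>
  define B where "B i = (if p i = i then ?V i else {p i})" for i
  have "of_int (sign p) *
      (\<Prod>c \<in> directed_cycles (graph_of ?U p). cycle_trace (extend \<tau>) (twisted_laplacian n h) c)
    = (\<Prod>c \<in> directed_cycles (graph_of ?U p). ?w c)"
    unfolding sign_eq_prod_cycles[OF p finite_atLeastAtMost] prod.distrib by simp
  also have "\<dots> = (\<Prod>i | i \<in> ?U \<and> p i = i. ?w {(i, i)}) * (\<Prod>c \<in> proper_cycles ?U p. ?w c)"
    by (rule prod_directed_cycles_split) simp
  also have "(\<Prod>i | i \<in> ?U \<and> p i = i. ?w {(i, i)})
      = (\<Prod>i | i \<in> ?U \<and> p i = i. \<Sum>k \<in> ?V i. indet (i, k))"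
    by (simp add: cycle_trace_twisted_laplacian_loop[OF \<tau>])
  also have "(\<Prod>c \<in> proper_cycles ?U p. ?w c)
      = (\<Prod>c \<in> proper_cycles ?U p. - const (cycle_trace \<tau> h c) * (\<Prod>e \<in> c. indet e))"
  proof (intro prod.cong refl)
    fix c assume "c \<in> proper_cycles ?U p"
    then have c: "c \<in> directed_cycles (graph_of ?U p)" "c \<inter> Id = {}"
      by (simp_all add: proper_cycles_def)
    show "?w c = - const (cycle_trace \<tau> h c) * (\<Prod>e \<in> c. indet e)"
      unfolding cycle_trace_twisted_laplacian[OF \<tau>(1,2) c] by (cases "even (card c)") simp_all
  qed
  also have "\<dots> = (\<Prod>c \<in> proper_cycles ?U p. - const (cycle_trace \<tau> h c)) *
      (\<Prod>i | i \<in> ?U \<and> p i \<noteq> i. indet (i, p i))"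
    unfolding prod.distrib prod_proper_cycles_edges[OF p finite_atLeastAtMost] ..
  finally have expand: "of_int (sign p) *
      (\<Prod>c \<in> directed_cycles (graph_of ?U p). cycle_trace (extend \<tau>) (twisted_laplacian n h) c)
    = (\<Prod>c \<in> proper_cycles ?U p. - const (cycle_trace \<tau> h c)) *
      ((\<Prod>i | i \<in> ?U \<and> p i = i. \<Sum>k \<in> ?V i. indet (i, k)) *
       (\<Prod>i | i \<in> ?U \<and> p i \<noteq> i. indet (i, p i)))"
    by (simp only: mult_ac)
  have "(\<Prod>i | i \<in> ?U \<and> p i = i. \<Sum>k \<in> ?V i. indet (i, k)) *
      (\<Prod>i | i \<in> ?U \<and> p i \<noteq> i. indet (i, p i))
    = (\<Prod>i \<in> ?U. if p i = i then \<Sum>k \<in> ?V i. indet (i, k) else indet (i, p i) :: 'k edge_poly)"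
  proof -
    have "{i. i \<in> ?U \<and> p i = i} = ?U \<inter> {i. p i = i}" "{i. i \<in> ?U \<and> p i \<noteq> i} = ?U \<inter> - {i. p i = i}"
      by auto
    then show ?thesis
      by (simp only: prod.If_cases finite_atLeastAtMost)
  qed
  also have "\<dots> = (\<Prod>i \<in> ?U. \<Sum>k \<in> B i. indet (i, k))"
    by (intro prod.cong) (simp_all add: B_def)
  also have "\<dots> = (\<Sum>g \<in> PiE ?U B. \<Prod>i \<in> ?U. indet (i, g i))"
    by (intro prod_sum_PiE) (simp_all add: B_def)
  also have "PiE ?U B = {g. g \<in> PiE ?U ?V \<and> (\<forall>i \<in> ?U. p i \<noteq> i \<longrightarrow> g i = p i)}"
  proof -
    have "p i \<in> {1..n}" if "i \<in> ?U" for i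
      using permutes_in_image[OF p, of i] that \<open>m \<le> n\<close> by auto
    then have "B i = {k \<in> ?V i. p i \<noteq> i \<longrightarrow> k = p i}" if "i \<in> ?U" for i
      using that by (auto simp: B_def)
    then have "PiE ?U B = PiE ?U (\<lambda>i. {k \<in> ?V i. p i \<noteq> i \<longrightarrow> k = p i})"
      by (rule PiE_cong)
    then show ?thesis
      unfolding set_eq_iff PiE_iff mem_Collect_eq by blast
  qed
  finally show ?thesis
    unfolding expand by simp
qed


section \<open>The matrix-tree theorem\<close>

lemma const_one_minus: "const (1 - t) = - const t + 1"
  for t :: "'k::comm_ring_1"
  by (simp add: const_def single_diff)

theorem theorem3p1:
  fixes n m :: nat
    and h :: "nat \<Rightarrow> nat \<Rightarrow> 'h::ring_1"
    and \<tau> :: "'h \<Rightarrow> 'k::comm_ring_1"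
  assumes "n \<ge> 2" and "m \<in> {1..n}"
    and "Modules.additive \<tau>" and "central \<tau>" and "\<tau> 1 = 1"
  shows "det_tau \<tau> m (twisted_laplacian n h) =
    (\<Sum>F \<in> forests n m.
       (\<Prod>e \<in> F. indet e) * (\<Prod>c \<in> directed_cycles F. const (1 - cycle_trace \<tau> h c)))"
proof -
  let ?U = "{1..m}"
  let ?G = "PiE ?U (\<lambda>i. {1..n} - {i})"
  let ?R = "\<lambda>p g. \<forall>i \<in> ?U. p i \<noteq> i \<longrightarrow> g i = p i"
  let ?t = "cycle_trace \<tau> h"
  let ?x = "\<lambda>p. \<Prod>c \<in> proper_cycles ?U p. - const (?t c)"
  let ?a = "\<lambda>g. \<Prod>i \<in> ?U. indet (i, g i) :: 'k edge_poly"
  have m: "m \<le> n" using assms(2) by simp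
  have "det_tau \<tau> m (twisted_laplacian n h) = (\<Sum>p | p permutes ?U. ?x p * (\<Sum>g | g \<in> ?G \<and> ?R p g. ?a g))"
    unfolding det_tau_def
    by (intro sum.cong refl det_tau_summand assms(3-5) m) simp
  also have "\<dots> = (\<Sum>p \<in> {p. p permutes ?U}. \<Sum>g | g \<in> ?G \<and> ?R p g. ?x p * ?a g)"
    by (simp only: sum_distrib_left)
  also have "\<dots> = (\<Sum>g \<in> ?G. \<Sum>p | p \<in> {p. p permutes ?U} \<and> ?R p g. ?x p * ?a g)"
    by (intro sum.swap_restrict finite_permutations finite_PiE) auto
  also have "\<dots> = (\<Sum>g \<in> ?G. (\<Prod>e \<in> graph_of ?U g. indet e) *
      (\<Prod>c \<in> directed_cycles (graph_of ?U g). const (1 - ?t c)))"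
  proof (intro sum.cong refl)
    fix g assume g: "g \<in> ?G"
    let ?D = "directed_cycles (graph_of ?U g)"
    have "finite ?D"
      by (intro finite_directed_cycles) (simp add: graph_of_eq_image)
    have nofix: "g i \<noteq> i" if "i \<in> ?U" for i
      using g that by (auto simp: PiE_iff)
    have "(\<Sum>p | p \<in> {p. p permutes ?U} \<and> ?R p g. ?x p) = (\<Sum>C \<in> Pow ?D. \<Prod>c \<in> C. - const (?t c))"
      using sum.reindex_bij_betw[OF bij_betw_proper_cycles[OF finite_atLeastAtMost nofix],
          where g = "\<lambda>C. \<Prod>c \<in> C. - const (?t c)"] by simp
    also have "\<dots> = (\<Prod>c \<in> ?D. const (1 - ?t c))"
      unfolding const_one_minus prod_add[OF \<open>finite ?D\<close>] by simp
    finally have "(\<Sum>p | p \<in> {p. p permutes ?U} \<and> ?R p g. ?x p) = \<dots>" .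
    moreover have "?a g = (\<Prod>e \<in> graph_of ?U g. indet e)"
      unfolding graph_of_eq_image by (subst prod.reindex) (auto simp: inj_on_def)
    ultimately show "(\<Sum>p | p \<in> {p. p permutes ?U} \<and> ?R p g. ?x p * ?a g)
        = (\<Prod>e \<in> graph_of ?U g. indet e) * (\<Prod>c \<in> ?D. const (1 - ?t c))"
      unfolding sum_distrib_right[symmetric] by (simp only: mult.commute)
  qed
  also have "\<dots> = (\<Sum>F \<in> forests n m.
       (\<Prod>e \<in> F. indet e) * (\<Prod>c \<in> directed_cycles F. const (1 - ?t c)))"
    by (rule sum.reindex_bij_betw[OF bij_betw_forests[OF m]])
  finally show ?thesis .
qed

end
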